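(* Let $k=k(n)=\omega(\lg n)$. There exist a language $L$ and an oracle $O$ such that for every $n$ and all $x_1,\ldots,x_k\in\{0,1\}^n$, $O(x_1,\ldots,x_k)$ is a bit-string $(b_1,\ldots,b_k)\in\{0,1\}^k$ with $(b_1,\ldots,b_k)\neq(L(x_1),\ldots,L(x_k))$, but there is no algorithm that computes $L$ in time polynomial in $n$ with oracle access to $O$, even when given $\mathrm{poly}(n)$ bits of advice (where the advice may depend on both $L$ and $O$).
   Context: $L(x)=1$ if $x\in L$ and $0$ otherwise. The statement expresses that $k$-membership comparability of $L$ cannot be shown to imply $L\in\mathrm{P/poly}$ by a proof that uses the algorithm excluding a $k$-tuple of answers only as a black box. *)

theory Defs
  imports
    Complex_Main
    "HOL-Library.Landau_Symbols"
    "HOL-Library.Finite_Map"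
    "HOL-Computational_Algebra.Polynomial"
begin

text \<open>
  Algorithms are deterministic multi-tape oracle Turing machines. Tape 0 holds the input, tape 1
  the advice, tape 2 is the query tape, tape 3 is the answer tape; a machine may have any number of
  further work tapes. All tapes are two-way infinite, readable and writable.
\<close>

datatype symbol = Blank | Bit bool | Sep | Mark nat

datatype state = Start | Query | Answered | Accept | Reject | State nat

datatype move = Go_Left | Stay | Go_Right

text \<open>
  The transition function is a finite map, so a machine has finitely many states and symbols. A rule
  maps the current state and the list of scanned symbols (one per tape) to the next state and, for
  each tape, the symbol to be written and the head move. A machine without an applicable rule is
  stuck forever, hence neither accepts nor rejects.
\<close>

record otm =
  work_tapes :: nat
  rules :: "(state \<times> symbol list, state \<times> (symbol \<times> move) list) fmap"

definition tape_count :: "otm \<Rightarrow> nat" where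
  "tape_count M = 4 + work_tapes M"

definition well_formed :: "otm \<Rightarrow> bool" where
  "well_formed M \<longleftrightarrow>
     (\<forall>q ss q' ws. fmlookup (rules M) (q, ss) = Some (q', ws) \<longrightarrow>
        length ss = tape_count M \<and> length ws = tape_count M)"

text \<open>A tape is its contents together with the position of the head.\<close>

type_synonym tape = "(int \<Rightarrow> symbol) \<times> int"

type_synonym config = "state \<times> tape list"

definition word_tape :: "symbol list \<Rightarrow> tape" where
  "word_tape w = ((\<lambda>i. if 0 \<le> i \<and> i < int (length w) then w ! nat i else Blank), 0)"

text \<open>The word written on a tape extends from cell 0 to just before the first blank cell.\<close>

definition tape_word :: "tape \<Rightarrow> symbol list" where
  "tape_word t = map (\<lambda>i. fst t (int i)) [0..<(LEAST i. fst t (int i) = Blank)]"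

definition scan :: "tape \<Rightarrow> symbol" where
  "scan t = fst t (snd t)"

fun act :: "symbol \<times> move \<Rightarrow> tape \<Rightarrow> tape" where
  "act (s, d) (c, h) =
     (c(h := s), case d of Go_Left \<Rightarrow> h - 1 | Stay \<Rightarrow> h | Go_Right \<Rightarrow> h + 1)"

text \<open>
  A tuple of bit-strings is written on the query tape with every component terminated (not merely
  separated) by \<^const>\<open>Sep\<close>; this makes the encoding injective.
\<close>

definition encode_tuple :: "bool list list \<Rightarrow> symbol list" where
  "encode_tuple xs = concat (map (\<lambda>x. map Bit x @ [Sep]) xs)"

lemma encode_component_cancel:
  "map Bit x @ Sep # u = map Bit y @ Sep # v \<Longrightarrow> x = y \<and> u = v"
proof (induction x arbitrary: y)
  case Nil
  then show ?case by (cases y) auto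
next
  case (Cons b x)
  then show ?case by (cases y) auto
qed

lemma inj_encode_tuple: "inj encode_tuple"
proof (rule injI)
  fix xs ys :: "bool list list"
  assume "encode_tuple xs = encode_tuple ys"
  then show "xs = ys"
  proof (induction xs arbitrary: ys)
    case Nil
    then show ?case by (cases ys) (auto simp: encode_tuple_def)
  next
    case (Cons x xs)
    then obtain y zs where ys: "ys = y # zs"
      by (cases ys) (auto simp: encode_tuple_def)
    with Cons.prems have "x = y \<and> encode_tuple xs = encode_tuple zs"
      by (intro encode_component_cancel) (simp add: encode_tuple_def)
    with Cons.IH ys show ?case by blast
  qed
qed

text \<open>
  An oracle maps tuples of bit-strings to bit-strings. A word that does not encode a tuple of
  bit-strings receives the empty answer.
\<close>

type_synonym oracle_fun = "bool list list \<Rightarrow> bool list"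

definition oracle_reply :: "oracle_fun \<Rightarrow> symbol list \<Rightarrow> bool list" where
  "oracle_reply orc w = (if w \<in> range encode_tuple then orc (inv encode_tuple w) else [])"

text \<open>
  In state \<^const>\<open>Query\<close> the oracle replaces, in a single step, the whole answer tape by its answer,
  with the answer tape's head on the first bit, and control passes to state \<^const>\<open>Answered\<close>. The
  states \<^const>\<open>Accept\<close> and \<^const>\<open>Reject\<close> are absorbing.
\<close>

definition step :: "otm \<Rightarrow> oracle_fun \<Rightarrow> config \<Rightarrow> config" where
  "step M orc = (\<lambda>(q, ts).
     if q = Accept \<or> q = Reject then (q, ts)
     else if q = Query then
       (Answered, ts[3 := word_tape (map Bit (oracle_reply orc (tape_word (ts ! 2))))])
     else
       (case fmlookup (rules M) (q, map scan ts) of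
          None \<Rightarrow> (q, ts)
        | Some (q', ws) \<Rightarrow> (q', map2 act ws ts)))"

definition initial :: "otm \<Rightarrow> bool list \<Rightarrow> bool list \<Rightarrow> config" where
  "initial M x adv =
     (Start, word_tape (map Bit x) # word_tape (map Bit adv) # replicate (2 + work_tapes M) (word_tape []))"

text \<open>
  \<open>a n\<close> is the advice given along with all inputs of length \<open>n\<close>. As halting states are absorbing,
  looking at the state after exactly \<open>T n\<close> steps bounds the running time by \<open>T n\<close>.
\<close>

definition computes_in_time ::
    "otm \<Rightarrow> oracle_fun \<Rightarrow> (nat \<Rightarrow> bool list) \<Rightarrow> (nat \<Rightarrow> nat) \<Rightarrow> bool list set \<Rightarrow> bool" where
  "computes_in_time M orc a T L \<longleftrightarrow>
     (\<forall>x. fst ((step M orc ^^ T (length x)) (initial M x (a (length x)))) =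
          (if x \<in> L then Accept else Reject))"

definition poly_time_computable_with_advice :: "oracle_fun \<Rightarrow> bool list set \<Rightarrow> bool" where
  "poly_time_computable_with_advice orc L \<longleftrightarrow>
     (\<exists>M (p :: nat poly) (a :: nat \<Rightarrow> bool list) (q :: nat poly).
        well_formed M \<and>
        (\<forall>n. length (a n) \<le> poly p n) \<and>
        computes_in_time M orc a (poly q) L)"

text \<open>
  For every \<open>k n\<close>-tuple of words of the same length \<open>n\<close>, the oracle names a vector of \<open>k n\<close> bits
  that differs from the vector of membership bits. Tuples of other shapes are unconstrained.
\<close>

definition excludes_membership_vector :: "(nat \<Rightarrow> nat) \<Rightarrow> bool list set \<Rightarrow> oracle_fun \<Rightarrow> bool" where
  "excludes_membership_vector k L orc \<longleftrightarrow>
     (\<forall>n xs. length xs = k n \<and> (\<forall>x\<in>set xs. length x = n) \<longrightarrow>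
        length (orc xs) = k n \<and> orc xs \<noteq> map (\<lambda>x. x \<in> L) xs)"

end

theory Submission
  imports Defs "HOL-Library.Countable_Set" "HOL-Library.FuncSet" "HOL-Real_Asymp.Real_Asymp"
begin

text \<open>
  At a suitable length \<open>n\<close> let \<open>L\<close> be a random subset of a set of \<open>P + 3\<close> words, where \<open>P\<close> bounds
  the advice, and let the oracle answer every tuple of distinct words with a random vector other than
  the membership vector. A fixed machine with fixed advice, run on all \<open>P + 3\<close> words, is a decision
  tree whose depth \<open>d\<close> is polynomial in \<open>n\<close>. Each leaf makes one guess at \<open>L\<close>, and so counting
  leaves bounds the probability of being right by \<open>2 ^ - (P + 3) * (1 + 1 / (2 ^ k - 1)) ^ d\<close>. The
  second factor is at most \<open>3\<close> because \<open>2 ^ k\<close> is superpolynomial, and this survives the union bound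
  over fewer than \<open>2 ^ (P + 1)\<close> advice strings. All triples of a machine and two polynomials are
  then defeated one after the other, at lengths so far apart that the run defeated at one stage is too
  short to write down any tuple that is changed at a later stage.
\<close>

section \<open>Decision trees and the number of correct guesses\<close>

text \<open>Trees are represented by the function they compute, so that a function defined
  otherwise, such as a run of a machine, can itself be shown to be one. The index \<open>d\<close>
  only bounds the depth, as a leaf may carry any index.\<close>

inductive decision_tree :: "'q set \<Rightarrow> nat \<Rightarrow> (('q \<Rightarrow> 'b) \<Rightarrow> 'r) \<Rightarrow> bool" for D where
  leaf: "decision_tree D d (\<lambda>_. r)"
| node: "q \<in> D \<Longrightarrow> (\<And>b. decision_tree D d (G b)) \<Longrightarrow> decision_tree D (Suc d) (\<lambda>f. G (f q) f)"

lemma decision_tree_mono: "decision_tree D d F \<Longrightarrow> d \<le> e \<Longrightarrow> decision_tree D e F"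
proof (induction arbitrary: e rule: decision_tree.induct)
  case (leaf d r)
  show ?case by (rule decision_tree.leaf)
next
  case (node q d G)
  then obtain e' where "e = Suc e'" "d \<le> e'"
    by (auto simp: Suc_le_eq dest: less_imp_Suc_add)
  with node show ?case by (auto intro: decision_tree.node)
qed

lemma decision_tree_bind:
  assumes "decision_tree D d F" and "\<And>r. decision_tree D e (H r)"
  shows "decision_tree D (d + e) (\<lambda>f. H (F f) f)"
  using assms(1)
proof (induction rule: decision_tree.induct)
  case (leaf d r)
  show ?case by (rule decision_tree_mono[OF assms(2)]) simp
next
  case (node q d G)
  then show ?case
    using decision_tree.node[where q = q and D = D and d = "d + e" and G = "\<lambda>b f. H (G b f) f"] by simp
qed

text \<open>Once the value at \<open>q\<close> is known to be \<open>b\<close>, a query to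
  \<open>q\<close> can be skipped by following branch \<open>b\<close>. Hence no point has to be
  counted twice along a path.\<close>

lemma decision_tree_fun_upd:
  "decision_tree D d F \<Longrightarrow> decision_tree (D - {q}) d (\<lambda>f. F (f(q := b)))"
proof (induction rule: decision_tree.induct)
  case (leaf d r)
  show ?case by (rule decision_tree.leaf)
next
  case (node q' d G)
  show ?case
  proof (cases "q' = q")
    case True
    then show ?thesis using decision_tree_mono[OF node.IH(1)[of b], of "Suc d"] by simp
  next
    case False
    then have "(\<lambda>f. G ((f(q := b)) q') (f(q := b))) = (\<lambda>f. (\<lambda>c f. G c (f(q := b))) (f q') f)"
      by simp
    moreover have "decision_tree (D - {q}) (Suc d) \<dots>"
      using node False by (intro decision_tree.node) auto
    ultimately show ?thesis by (simp only:)
  qed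
qed

text \<open>
  Every leaf of a decision tree of depth \<open>d\<close> fixes the guess for \<open>L\<close> and the answers to \<open>d\<close>
  queries. So it accounts for at most \<open>B ^ (card D - d)\<close> pairs, and there are \<open>A ^ d\<close> leaves.
\<close>

lemma sum_card_correct_guesses_le:
  assumes "decision_tree D d F" and "finite D" and "finite \<L>" and "finite S"
    and W: "\<And>L q. q \<in> D \<Longrightarrow> W L q \<subseteq> S \<and> card (W L q) \<le> B"
    and B: "0 < B" "B \<le> card S"
  shows "(\<Sum>L\<in>\<L>. real (card {f \<in> PiE D (W L). F f = L})) \<le>
           real B ^ card D * (real (card S) / real B) ^ d"
  using assms(1,2) W
proof (induction d arbitrary: D F)
  \<comment> \<open>A constant guess is right for at most one \<open>L\<close>, and the factor
    \<open>(card S / B) ^ d\<close> is at least 1. This serves depth 0 and also leaves reached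
    early.\<close>
  have const: "(\<Sum>L\<in>\<L>. real (card {f \<in> PiE D (W L). r = L})) \<le>
           real B ^ card D * (real (card S) / real B) ^ d"
    if "finite D" and W: "\<And>L q. q \<in> D \<Longrightarrow> W L q \<subseteq> S \<and> card (W L q) \<le> B" for D d r
  proof -
    have "(\<Sum>L\<in>\<L>. real (card {f \<in> PiE D (W L). r = L})) =
        (\<Sum>L\<in>\<L>. if r = L then real (card (PiE D (W L))) else 0)"
      by (rule sum.cong) auto
    also have "\<dots> \<le> real (card (PiE D (W r)))"
      using \<open>finite \<L>\<close> by simp
    also have "card (PiE D (W r)) \<le> B ^ card D"
      unfolding card_PiE[OF \<open>finite D\<close>] using W B(1) by (intro prod_le_power) auto
    also have "real (B ^ card D) \<le> real B ^ card D * (real (card S) / real B) ^ d"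
      using B by (simp add: mult_le_cancel_left1 one_le_power)
    finally show ?thesis by simp
  qed
  {
    case 0
    from 0(1) obtain r where F: "F = (\<lambda>_. r)" by cases auto
    show ?case unfolding F by (rule const) (use 0 in auto)
  next
    case (Suc d)
    from Suc.prems(1) show ?case
    proof cases
      case (leaf r)
      show ?thesis unfolding leaf by (rule const) (use Suc.prems in auto)
    next
      case (node q G)
      let ?D = "D - {q}"
      let ?C = "\<lambda>L b. {f \<in> PiE ?D (W L). G b (f(q := b)) = L}"
      have fin: "finite (?C L b)" for L b
      proof (rule finite_subset)
        show "?C L b \<subseteq> PiE ?D (W L)" by auto
        show "finite (PiE ?D (W L))"
          using Suc.prems(2,3) \<open>finite S\<close> by (intro finite_PiE) (auto intro: finite_subset)
      qed
      \<comment> \<open>The branches run over all of \<open>S\<close>, although \<open>f q\<close>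
        lies in \<open>W L q\<close>: a range that does not depend on \<open>L\<close> allows the
        sums to be swapped.\<close>
      have "real (card {f \<in> PiE D (W L). F f = L}) \<le> (\<Sum>b\<in>S. real (card (?C L b)))" for L
      proof -
        have "{f \<in> PiE D (W L). F f = L} \<subseteq> (\<Union>b\<in>S. (\<lambda>f. f(q := b)) ` ?C L b)"
        proof
          fix f assume f: "f \<in> {f \<in> PiE D (W L). F f = L}"
          then have q: "f q \<in> S" using node(2) Suc.prems(3) by (auto simp: PiE_iff)
          have "f = (f(q := undefined))(q := f q)" by simp
          moreover have "f(q := undefined) \<in> ?C L (f q)"
            using f by (auto simp: node PiE_iff extensional_def)
          ultimately show "f \<in> (\<Union>b\<in>S. (\<lambda>f. f(q := b)) ` ?C L b)" using q by blast
        qed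
        then have "card {f \<in> PiE D (W L). F f = L} \<le> card (\<Union>b\<in>S. (\<lambda>f. f(q := b)) ` ?C L b)"
          using fin \<open>finite S\<close> by (intro card_mono) auto
        also have "\<dots> \<le> (\<Sum>b\<in>S. card ((\<lambda>f. f(q := b)) ` ?C L b))"
          by (rule card_UN_le[OF \<open>finite S\<close>])
        also have "\<dots> \<le> (\<Sum>b\<in>S. card (?C L b))"
          using fin by (intro sum_mono card_image_le)
        finally show ?thesis unfolding of_nat_sum[symmetric] of_nat_le_iff .
      qed
      then have "(\<Sum>L\<in>\<L>. real (card {f \<in> PiE D (W L). F f = L})) \<le>
          (\<Sum>L\<in>\<L>. \<Sum>b\<in>S. real (card (?C L b)))"
        by (intro sum_mono)
      also have "\<dots> = (\<Sum>b\<in>S. \<Sum>L\<in>\<L>. real (card (?C L b)))"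
        by (rule sum.swap)
      also have "\<dots> \<le> (\<Sum>b\<in>S. real B ^ card ?D * (real (card S) / real B) ^ d)"
      proof (rule sum_mono)
        fix b
        show "(\<Sum>L\<in>\<L>. real (card (?C L b))) \<le> real B ^ card ?D * (real (card S) / real B) ^ d"
          by (rule Suc.IH[OF decision_tree_fun_upd[OF node(3)]]) (use Suc.prems in auto)
      qed
      \<comment> \<open>There are \<open>card S\<close> branches, while removing \<open>q\<close>
        from \<open>D\<close> gains only a factor \<open>B\<close>; each query thus costs
        \<open>card S / B\<close>.\<close>
      also have "\<dots> = real B ^ card D * (real (card S) / real B) ^ Suc d"
      proof -
        have "card D = Suc (card ?D)"
          using node(2) Suc.prems(2) by (rule card.remove[rotated])
        then have "real B ^ card D = real B * real B ^ card ?D" by simp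
        with B(1) show ?thesis by simp
      qed
      finally show ?thesis .
    qed
  }
qed

section \<open>Countability of machines and polynomials\<close>

instance symbol :: countable by countable_datatype
instance state :: countable by countable_datatype
instance move :: countable by countable_datatype

lemma countable_otm: "countable (UNIV :: otm set)"
  by (rule countableI'[where f = "\<lambda>M. (work_tapes M, rules M)"]) (auto intro!: injI otm.equality)

lemma countable_nat_poly: "countable (UNIV :: nat poly set)"
  by (rule countableI'[where f = coeffs]) (auto intro: injI simp: coeffs_eq_iff)

section \<open>Length of queries and locality of runs\<close>

definition nonblank :: "tape \<Rightarrow> int set" where
  "nonblank t = {i. fst t i \<noteq> Blank}"

lemma tape_word_length_le:
  assumes "finite (nonblank t)"
  shows "length (tape_word t) \<le> card (nonblank t)"
proof -
  let ?l = "LEAST i. fst t (int i) = Blank"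
  have "int ` {..<?l} \<subseteq> nonblank t"
    using not_less_Least by (fastforce simp: nonblank_def)
  with assms have "card (int ` {..<?l}) \<le> card (nonblank t)"
    by (rule card_mono)
  then show ?thesis by (simp add: tape_word_def card_image)
qed

text \<open>The query tape starts blank and a step writes at most one of its cells. Finiteness is
  carried along because \<open>card\<close> is 0 on infinite sets, the number of tapes because tape
  2 has to survive \<open>map2\<close>.\<close>

lemma query_tape_bound:
  assumes "well_formed M"
  shows "(case (step M orc ^^ j) (initial M x a) of (q, ts) \<Rightarrow>
            length ts = tape_count M \<and> finite (nonblank (ts ! 2)) \<and> card (nonblank (ts ! 2)) \<le> j)"
proof (induction j)
  case 0
  have "nonblank (word_tape []) = {}" by (auto simp: nonblank_def word_tape_def)
  then show ?case by (simp add: initial_def tape_count_def numeral_2_eq_2)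
next
  case (Suc j)
  obtain q ts where c: "(step M orc ^^ j) (initial M x a) = (q, ts)" by fastforce
  with Suc have IH: "length ts = tape_count M" "finite (nonblank (ts ! 2))" "card (nonblank (ts ! 2)) \<le> j"
    by auto
  have sub: "nonblank (act w t) \<subseteq> insert (snd t) (nonblank t)" for w t
    by (cases w; cases t) (auto simp: nonblank_def)
  have act: "finite (nonblank (act w t)) \<and> card (nonblank (act w t)) \<le> Suc (card (nonblank t))"
    if fin: "finite (nonblank t)" for w t
  proof
    show "finite (nonblank (act w t))"
      by (rule finite_subset[OF sub]) (simp add: fin)
    have "card (nonblank (act w t)) \<le> card (insert (snd t) (nonblank t))"
      by (rule card_mono[OF _ sub]) (simp add: fin)
    also have "\<dots> \<le> Suc (card (nonblank t))" using fin by (simp add: card_insert_if)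
    finally show "card (nonblank (act w t)) \<le> Suc (card (nonblank t))" .
  qed
  have "fmlookup (rules M) (q, map scan ts) = Some (q', ws) \<Longrightarrow> length ws = length ts" for q' ws
    using assms IH(1) unfolding well_formed_def by metis
  moreover have "2 < length ts" using IH(1) by (simp add: tape_count_def)
  ultimately have "case step M orc (q, ts) of (q, ts) \<Rightarrow>
      length ts = tape_count M \<and> finite (nonblank (ts ! 2)) \<and> card (nonblank (ts ! 2)) \<le> Suc j"
    using IH act[OF IH(2)] order_trans[OF conjunct2[OF act[OF IH(2)]], of "Suc j"]
    by (auto simp: step_def split: option.splits intro: le_SucI le_trans)
  with c show ?case by simp
qed

text \<open>Within \<open>T\<close> steps no word longer than \<open>T\<close> gets onto the query
  tape, so tuples on which the oracles may differ are never asked.\<close>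

lemma step_cong_short_queries:
  assumes M: "well_formed M"
    and agree: "\<And>xs. length (encode_tuple xs) \<le> T \<Longrightarrow> orc xs = orc' xs"
  shows "j \<le> T \<Longrightarrow> (step M orc ^^ j) (initial M x a) = (step M orc' ^^ j) (initial M x a)"
proof (induction j)
  case 0
  show ?case by simp
next
  case (Suc j)
  obtain q ts where c: "(step M orc ^^ j) (initial M x a) = (q, ts)" by fastforce
  from query_tape_bound[OF M, of j orc x a] have "length (tape_word (ts ! 2)) \<le> j"
    using tape_word_length_le[of "ts ! 2"] by (auto simp: c)
  then have "oracle_reply orc (tape_word (ts ! 2)) = oracle_reply orc' (tape_word (ts ! 2))"
    using Suc.prems agree by (auto simp: oracle_reply_def inv_f_f[OF inj_encode_tuple])
  then have "step M orc (q, ts) = step M orc' (q, ts)"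
    by (simp add: step_def)
  with Suc c show ?case by simp
qed

section \<open>Runs as decision trees\<close>

text \<open>The configuration alone decides which tuple is asked, if any. If it lies in
  \<open>D\<close>, this is one query to \<open>f\<close>; otherwise the step is a leaf, as
  \<open>orc\<close> is fixed.\<close>

lemma decision_tree_step: "decision_tree D 1 (\<lambda>f. step M (override_on orc f D) c)"
proof -
  obtain q ts where c: "c = (q, ts)" by fastforce
  define w where "w = tape_word (ts ! 2)"
  show ?thesis
  proof (cases "q = Query \<and> w \<in> range encode_tuple \<and> inv encode_tuple w \<in> D")
    case True
    then have "(\<lambda>f. step M (override_on orc f D) c) =
        (\<lambda>f. (\<lambda>b _. (Answered, ts[3 := word_tape (map Bit b)])) (f (inv encode_tuple w)) f)"
      by (auto simp: c step_def oracle_reply_def w_def)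
    moreover have "decision_tree D (Suc 0) \<dots>"
      using True by (intro decision_tree.node decision_tree.leaf) auto
    ultimately show ?thesis by simp
  next
    case False
    then have "step M (override_on orc f D) c = step M orc c" for f
      by (auto simp: c step_def oracle_reply_def w_def)
    then show ?thesis by (simp add: decision_tree.leaf)
  qed
qed

lemma decision_tree_steps: "decision_tree D T (\<lambda>f. (step M (override_on orc f D) ^^ T) c)"
proof (induction T)
  case 0
  show ?case by (simp add: decision_tree.leaf)
next
  case (Suc T)
  from decision_tree_bind[OF this decision_tree_step] show ?case by simp
qed

text \<open>The trees for the elements of \<open>X\<close> are run one after the other, so their
  depths add up.\<close>

lemma decision_tree_Collect:
  assumes "finite X" and "\<And>x. decision_tree D T (P x)"
  shows "decision_tree D (card X * T) (\<lambda>f. {x \<in> X. P x f})"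
  using assms(1)
proof (induction X rule: finite_induct)
  case empty
  show ?case by (simp add: decision_tree.leaf)
next
  case (insert y X)
  have "decision_tree D (T + 0) (\<lambda>f. (\<lambda>b f. if b then insert y r else r) (P y f) f)" for r
    by (rule decision_tree_bind[OF assms(2)]) (rule decision_tree.leaf)
  from decision_tree_bind[OF insert.IH this]
  have "decision_tree D (card X * T + T) (\<lambda>f. if P y f then insert y {x \<in> X. P x f} else {x \<in> X. P x f})"
    by simp
  moreover have "(if P y f then insert y {x \<in> X. P x f} else {x \<in> X. P x f}) = {x \<in> insert y X. P x f}" for f
    by auto
  ultimately show ?case using insert.hyps by (simp add: add.commute)
qed

section \<open>Defeating one machine at one length\<close>

text \<open>The failing word may depend on the advice, since one advice string serves all inputs of
  length \<open>n\<close>. \<open>P\<close> and \<open>T\<close> stand for the values of the two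
  polynomials at \<open>n\<close>.\<close>

definition fails_at_length :: "otm \<Rightarrow> nat \<Rightarrow> nat \<Rightarrow> nat \<Rightarrow> oracle_fun \<Rightarrow> bool list set \<Rightarrow> bool" where
  "fails_at_length M P T n orc L \<longleftrightarrow>
     (\<forall>a. length a \<le> P \<longrightarrow>
        (\<exists>x. length x = n \<and>
             fst ((step M orc ^^ T) (initial M x a)) \<noteq> (if x \<in> L then Accept else Reject)))"

lemma finite_lists_length_le_bool: "finite {a :: bool list. length a \<le> P}"
  using finite_lists_length_le[of "UNIV :: bool set" P] by simp

lemma card_lists_length_eq_bool: "card {b :: bool list. length b = k} = 2 ^ k"
  using card_lists_length_eq[of "UNIV :: bool set" k] by simp

lemma finite_lists_length_eq_bool: "finite {b :: bool list. length b = k}"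
  using finite_lists_length_eq[of "UNIV :: bool set" k] by simp

lemma card_lists_length_le_bool: "card {a :: bool list. length a \<le> P} \<le> 2 ^ Suc P"
proof -
  have "card {a :: bool list. length a \<le> P} = (\<Sum>i\<le>P. 2 ^ i)"
    using card_lists_length_le[of "UNIV :: bool set" P] by simp
  also have "\<dots> = (\<Sum>i<Suc P. 2 ^ i)"
    by (simp add: lessThan_Suc_atMost)
  also have "\<dots> \<le> (2 :: nat) ^ Suc P"
    by (induction P) auto
  finally show ?thesis .
qed

text \<open>If no pair \<open>(L, f)\<close> defeats the machine, each pair is guessed right under
  some advice. But at most \<open>2 ^ (P + 1)\<close> advice strings, each right for at most
  \<open>3 * B ^ card D\<close> pairs, cannot cover all \<open>2 ^ (P + 3) * B ^ card D\<close>
  pairs.\<close>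

lemma ex_override_fails_at_length:
  fixes D :: "bool list list set"
  assumes "finite D" and D: "\<And>xs. xs \<in> D \<Longrightarrow> length xs = k" and "0 < k"
    and "finite X" and X: "\<And>x. x \<in> X \<Longrightarrow> length x = n"
    and card_X: "card X = P + 3" and T: "(P + 3) * T < 2 ^ k"
  shows "\<exists>L\<subseteq>X. \<exists>f. (\<forall>xs\<in>D. length (f xs) = k \<and> f xs \<noteq> map (\<lambda>x. x \<in> L) xs) \<and>
           fails_at_length M P T n (override_on orc f D) L"
proof (rule ccontr)
  assume *: "\<not> ?thesis"
  define S where "S = {b :: bool list. length b = k}"
  define B :: nat where "B = 2 ^ k - 1"
  define W where "W L xs = S - {map (\<lambda>x. x \<in> L) xs}" for L and xs :: "bool list list"
  define A where "A = {a :: bool list. length a \<le> P}"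
  define d where "d = (P + 3) * T"
  define acc where "acc a f = {x \<in> X. fst ((step M (override_on orc f D) ^^ T) (initial M x a)) = Accept}" for a f
  have fin_S: "finite S" and card_S: "card S = 2 ^ k"
    unfolding S_def by (rule finite_lists_length_eq_bool card_lists_length_eq_bool)+
  have "(2 :: nat) ^ 1 \<le> 2 ^ k" using \<open>0 < k\<close> by (intro power_increasing) auto
  then have B: "0 < B" "B \<le> card S" "card S = Suc B" by (auto simp: card_S B_def)
  have W: "W L xs \<subseteq> S" "card (W L xs) = B" if "xs \<in> D" for L xs
  proof -
    have "map (\<lambda>x. x \<in> L) xs \<in> S" using D[OF that] by (simp add: S_def)
    then show "card (W L xs) = B" using fin_S B(3) by (simp add: W_def)
  qed (auto simp: W_def)
  have fin_W: "finite (PiE D (W L))" for L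
    using \<open>finite D\<close> fin_S by (intro finite_PiE) (auto simp: W_def)
  have "decision_tree D T (\<lambda>f. fst ((step M (override_on orc f D) ^^ T) c) = Accept)" for c
    using decision_tree_bind[OF decision_tree_steps[of D T M orc c], where e = 0 and H = "\<lambda>c f. fst c = Accept"]
    by (simp add: decision_tree.leaf)
  then have tree: "decision_tree D d (acc a)" for a
    unfolding acc_def d_def card_X[symmetric] using \<open>finite X\<close> by (intro decision_tree_Collect)
  \<comment> \<open>A machine that is right on all words of length \<open>n\<close> accepts exactly
    \<open>L\<close> among the words of \<open>X\<close>, as \<open>L \<subseteq> X\<close>.\<close>
  have covered: "\<exists>a\<in>A. acc a f = L" if L: "L \<subseteq> X" and f: "f \<in> PiE D (W L)" for L f
  proof -
    have "\<forall>xs\<in>D. length (f xs) = k \<and> f xs \<noteq> map (\<lambda>x. x \<in> L) xs"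
      using f by (auto simp: W_def S_def PiE_iff)
    with * L have "\<not> fails_at_length M P T n (override_on orc f D) L" by blast
    then obtain a where "a \<in> A" and
      a: "\<And>x. length x = n \<Longrightarrow> fst ((step M (override_on orc f D) ^^ T) (initial M x a)) =
            (if x \<in> L then Accept else Reject)"
      by (auto simp: fails_at_length_def A_def)
    have "acc a f = L" using a X L by (auto simp: acc_def split: if_splits)
    with \<open>a \<in> A\<close> show ?thesis ..
  qed
  \<comment> \<open>Each \<open>W L xs\<close> has exactly \<open>B\<close> elements, so every
    \<open>L\<close> admits the same number of oracles.\<close>
  have "2 ^ (P + 3) * real B ^ card D = (\<Sum>L\<in>Pow X. real (card (PiE D (W L))))"
    using \<open>finite X\<close> \<open>finite D\<close> card_X by (simp add: card_PiE W card_Pow)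
  also have "\<dots> \<le> (\<Sum>L\<in>Pow X. \<Sum>a\<in>A. real (card {f \<in> PiE D (W L). acc a f = L}))"
  proof (rule sum_mono)
    fix L assume "L \<in> Pow X"
    then have "L \<subseteq> X" by simp
    have "PiE D (W L) \<subseteq> (\<Union>a\<in>A. {f \<in> PiE D (W L). acc a f = L})"
    proof
      fix f assume f: "f \<in> PiE D (W L)"
      with covered[OF \<open>L \<subseteq> X\<close>] obtain a where "a \<in> A" "acc a f = L" by blast
      with f show "f \<in> (\<Union>a\<in>A. {f \<in> PiE D (W L). acc a f = L})"
        by (intro UN_I[of a]) auto
    qed
    then have "card (PiE D (W L)) \<le> card (\<Union>a\<in>A. {f \<in> PiE D (W L). acc a f = L})"
      using fin_W by (intro card_mono) (auto simp: A_def finite_lists_length_le_bool)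
    also have "\<dots> \<le> (\<Sum>a\<in>A. card {f \<in> PiE D (W L). acc a f = L})"
      by (rule card_UN_le) (simp add: A_def finite_lists_length_le_bool)
    finally show "real (card (PiE D (W L))) \<le> (\<Sum>a\<in>A. real (card {f \<in> PiE D (W L). acc a f = L}))"
      unfolding of_nat_sum[symmetric] of_nat_le_iff .
  qed
  also have "\<dots> = (\<Sum>a\<in>A. \<Sum>L\<in>Pow X. real (card {f \<in> PiE D (W L). acc a f = L}))"
    by (rule sum.swap)
  also have "\<dots> \<le> (\<Sum>a\<in>A. real B ^ card D * (real (card S) / real B) ^ d)"
    using \<open>finite D\<close> \<open>finite X\<close> fin_S W B by (intro sum_mono sum_card_correct_guesses_le tree) auto
  also have "\<dots> = real (card A) * (real B ^ card D * (real (card S) / real B) ^ d)"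
    by simp
  also have "\<dots> \<le> 2 ^ Suc P * (real B ^ card D * 3)"
  proof (intro mult_mono mult_left_mono)
    show "real (card A) \<le> 2 ^ Suc P"
      unfolding A_def using card_lists_length_le_bool[of P] by (metis of_nat_le_iff of_nat_numeral of_nat_power)
    have "(real (card S) / real B) ^ d = (1 + 1 / real B) ^ d"
      using B by (simp add: field_simps)
    also have "\<dots> \<le> exp (1 / real B) ^ d"
      by (intro power_mono exp_ge_add_one_self) auto
    also have "\<dots> = exp (real d / real B)"
      by (simp flip: exp_of_nat_mult)
    also have "\<dots> \<le> exp 1"
    proof -
      \<comment> \<open>The strict bound on \<open>(P + 3) * T\<close> is what gives
        \<open>d \<le> 2 ^ k - 1\<close>.\<close>
      have "d \<le> B" using T by (simp add: d_def B_def)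
      with B(1) show ?thesis by simp
    qed
    also have "\<dots> \<le> 3" by (rule exp_le)
    finally show "(real (card S) / real B) ^ d \<le> 3" .
  qed auto
  \<comment> \<open>\<open>2 ^ (P + 3) = 8 * 2 ^ P\<close> exceeds
    \<open>2 ^ (P + 1) * 3 = 6 * 2 ^ P\<close>; with \<open>P + 2\<close> words this estimate would
    not suffice.\<close>
  finally show False using B(1) by (simp add: power_add)
qed

section \<open>Polynomials against \<open>2 ^ k n\<close>\<close>

text \<open>Horner's rule raises the exponent by two per coefficient: one factor \<open>n\<close>
  comes from the multiplication by the variable, the other, being at least 2, absorbs the added
  coefficient.\<close>

lemma poly_le_power_eventually:
  fixes p :: "nat poly"
  shows "\<exists>c. eventually (\<lambda>n. poly p n < n ^ c) sequentially"
proof (induction p)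
  case 0
  have "eventually (\<lambda>n. poly 0 n < n ^ 1) sequentially"
    using eventually_gt_at_top[of 0] by simp
  then show ?case ..
next
  case (pCons b p)
  then obtain c where "eventually (\<lambda>n. poly p n < n ^ c) sequentially" by blast
  then have "eventually (\<lambda>n. poly (pCons b p) n < n ^ Suc (Suc c)) sequentially"
    using eventually_gt_at_top[of "Suc b"]
  proof eventually_elim
    case (elim n)
    have "n * poly p n \<le> n * n ^ c" using elim by simp
    moreover have "b < n * n ^ c"
      using elim by (metis less_le_trans mult.right_neutral mult_le_mono2 Suc_lessD Suc_leI zero_less_Suc One_nat_def)
    ultimately have "poly (pCons b p) n < 2 * (n * n ^ c)"
      unfolding poly_pCons by linarith
    also have "\<dots> \<le> n ^ Suc (Suc c)" using elim by (simp add: mult_le_mono1)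
    finally show ?case .
  qed
  then show ?case ..
qed

text \<open>For each constant \<open>c\<close>, eventually \<open>k n \<ge> c * log 2 n\<close>,
  hence \<open>2 ^ k n \<ge> n ^ c\<close>, which dominates the polynomial for suitable
  \<open>c\<close>.\<close>

lemma eventually_poly_less_two_power:
  fixes p :: "nat poly" and k :: "nat \<Rightarrow> nat"
  assumes "(\<lambda>n. real (k n)) \<in> \<omega>(\<lambda>n. log 2 (real n))"
  shows "eventually (\<lambda>n. poly p n < 2 ^ k n) sequentially"
proof -
  obtain c where "eventually (\<lambda>n. poly p n < n ^ c) sequentially"
    using poly_le_power_eventually by blast
  with smallomegaD[OF assms, of "real c"] show ?thesis
    using eventually_ge_at_top[of 1]
  proof eventually_elim
    case (elim n)
    have "real n ^ c = 2 powr (log 2 (real n) * real c)"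
      using elim by (simp add: powr_powr[symmetric] powr_realpow)
    also have "\<dots> \<le> 2 powr real (k n)"
      using elim by (intro powr_mono) (auto simp: mult.commute)
    also have "\<dots> = 2 ^ k n" by (simp add: powr_realpow)
    finally have "n ^ c \<le> 2 ^ k n"
      by (metis of_nat_le_iff of_nat_numeral of_nat_power)
    with elim show ?case by simp
  qed
qed

section \<open>One stage of the construction\<close>

text \<open>On tuples of words of one length this is that length. Using the first word extends it to
  all tuples, so that every tuple has a stage after which its answer is final.\<close>

definition tuple_length :: "bool list list \<Rightarrow> nat" where
  "tuple_length xs = (case xs of [] \<Rightarrow> 0 | x # _ \<Rightarrow> length x)"

lemma tuple_length_le_encode: "tuple_length xs \<le> length (encode_tuple xs)"
  by (cases xs) (auto simp: tuple_length_def encode_tuple_def)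

lemma tuple_length_eq: "0 < length xs \<Longrightarrow> \<forall>x\<in>set xs. length x = n \<Longrightarrow> tuple_length xs = n"
  by (cases xs) (auto simp: tuple_length_def)

text \<open>A run of \<open>T\<close> steps can only ask tuples whose \<open>tuple_length\<close> is
  at most \<open>T \<le> N\<close>, where the oracles agree.\<close>

lemma fails_at_length_cong:
  assumes "well_formed M" "fails_at_length M P T n orc L" "T \<le> N" "n \<le> N"
    and "\<And>xs. tuple_length xs \<le> N \<Longrightarrow> orc' xs = orc xs"
    and "\<And>x. length x \<le> N \<Longrightarrow> x \<in> L' \<longleftrightarrow> x \<in> L"
  shows "fails_at_length M P T n orc' L'"
proof -
  have "orc' xs = orc xs" if "length (encode_tuple xs) \<le> T" for xs
    using that assms(3,5) tuple_length_le_encode[of xs] by simp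
  then have "(step M orc' ^^ T) (initial M x a) = (step M orc ^^ T) (initial M x a)" for x a
    by (intro step_cong_short_queries[OF assms(1), of T]) auto
  then show ?thesis
    using assms(2,4,6) unfolding fails_at_length_def by metis
qed

text \<open>
  A tuple with few distinct words has so few possible membership vectors that excluding one of them
  could reveal a lot. An answer that is inconsistent on equal words reveals nothing.
\<close>

definition rejects_repetitions :: "oracle_fun \<Rightarrow> bool" where
  "rejects_repetitions orc \<longleftrightarrow>
     (\<forall>xs. \<not> distinct xs \<longrightarrow> length (orc xs) = length xs \<and> (\<forall>g. orc xs \<noteq> map g xs))"

text \<open>The membership vector of the empty language is all \<open>False\<close>. The answer to a
  distinct tuple is all \<open>True\<close>, which differs because
  \<open>k n \<ge> 1\<close>.\<close>

lemma ex_initial_oracle: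
  assumes "\<And>n. 1 \<le> k n"
  shows "\<exists>orc :: oracle_fun. rejects_repetitions orc \<and> excludes_membership_vector k {} orc"
proof -
  have ex: "\<exists>b :: bool list. length b = length xs \<and> (\<forall>g. b \<noteq> map g xs)" if "\<not> distinct xs" for xs :: "bool list list"
  proof -
    from that obtain i j where ij: "i < length xs" "j < length xs" "i \<noteq> j" "xs ! i = xs ! j"
      by (auto simp: distinct_conv_nth)
    \<comment> \<open>The equal words at \<open>i\<close> and \<open>j\<close> receive different
      bits.\<close>
    let ?b = "(replicate (length xs) False)[i := True]"
    have "?b ! i \<noteq> ?b ! j" using ij by simp
    then have "?b \<noteq> map g xs" for g using ij by (metis nth_map)
    then show ?thesis by (intro exI[of _ ?b]) simp
  qed
  define orc :: oracle_fun where "orc xs = (if distinct xs then replicate (length xs) True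
      else SOME b. length b = length xs \<and> (\<forall>g. b \<noteq> map g xs))" for xs
  have rep: "rejects_repetitions orc"
    unfolding rejects_repetitions_def
  proof (intro allI impI)
    fix xs :: "bool list list" assume xs: "\<not> distinct xs"
    show "length (orc xs) = length xs \<and> (\<forall>g. orc xs \<noteq> map g xs)"
      using someI_ex[OF ex[OF xs]] xs by (simp add: orc_def)
  qed
  moreover have "excludes_membership_vector k {} orc"
    unfolding excludes_membership_vector_def
  proof (intro allI impI)
    fix n and xs :: "bool list list" assume xs: "length xs = k n \<and> (\<forall>x\<in>set xs. length x = n)"
    show "length (orc xs) = k n \<and> orc xs \<noteq> map (\<lambda>x. x \<in> {}) xs"
    proof (cases "distinct xs")
      case True
      with xs assms[of n] show ?thesis by (auto simp: orc_def map_replicate_const)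
    next
      case False
      with rep xs show ?thesis unfolding rejects_repetitions_def by metis
    qed
  qed
  ultimately show ?thesis by blast
qed

text \<open>A length \<open>n > N\<close> is chosen at which counting applies; \<open>L\<close>
  changes only at length \<open>n\<close>, and the oracle only on distinct tuples of words of that
  length.\<close>

lemma ex_next_stage:
  assumes k_pos: "\<And>n. 1 \<le> k n"
    and k_growth: "(\<lambda>n. real (k n)) \<in> \<omega>(\<lambda>n. log 2 (real n))"
    and rep: "rejects_repetitions orc" and exc: "excludes_membership_vector k L orc"
    and L: "\<And>x. x \<in> L \<Longrightarrow> length x \<le> N"
  shows "\<exists>orc' L' N' n. rejects_repetitions orc' \<and> excludes_membership_vector k L' orc' \<and>
           (\<forall>x\<in>L'. length x \<le> N') \<and> N < N' \<and>
           (\<forall>xs. tuple_length xs \<le> N \<longrightarrow> orc' xs = orc xs) \<and>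
           (\<forall>x. length x \<le> N \<longrightarrow> (x \<in> L' \<longleftrightarrow> x \<in> L)) \<and>
           n \<le> N' \<and> poly q n \<le> N' \<and> fails_at_length M (poly p n) (poly q n) n orc' L'"
proof -
  \<comment> \<open>With the identity in place of \<open>k\<close>, the growth lemma provides
    \<open>poly p n + 3\<close> words of length \<open>n\<close>.\<close>
  have "(\<lambda>n. real n) \<in> \<omega>(\<lambda>n. log 2 (real n))" by real_asymp
  then have "eventually (\<lambda>n. poly (p + [:3:]) n < 2 ^ n) sequentially"
    by (rule eventually_poly_less_two_power)
  moreover have "eventually (\<lambda>n. poly ((p + [:3:]) * q) n < 2 ^ k n) sequentially"
    by (rule eventually_poly_less_two_power[OF k_growth])
  ultimately have "eventually (\<lambda>n. N < n \<and> poly p n + 3 < 2 ^ n \<and> (poly p n + 3) * poly q n < 2 ^ k n) sequentially"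
    using eventually_gt_at_top[of N] by eventually_elim simp
  then obtain n where n: "N < n" "poly p n + 3 < 2 ^ n" "(poly p n + 3) * poly q n < 2 ^ k n"
    using eventually_happens'[OF sequentially_bot] by blast
  obtain X :: "bool list set" where X: "X \<subseteq> {x. length x = n}" "card X = poly p n + 3" "finite X"
    using obtain_subset_with_card_n[of "poly p n + 3" "{x :: bool list. length x = n}"] n(2)
    by (auto simp: card_lists_length_eq_bool)
  define D where "D = {xs :: bool list list. length xs = k n \<and> distinct xs \<and> (\<forall>x\<in>set xs. length x = n)}"
  have "finite D"
    by (rule finite_subset[OF _ finite_lists_length_eq[OF finite_lists_length_eq_bool[of n], of "k n"]])
       (auto simp: D_def)
  have len_D: "length xs = k n" if "xs \<in> D" for xs using that by (simp add: D_def)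
  have len_X: "length x = n" if "x \<in> X" for x using that X(1) by auto
  have "0 < k n" using k_pos[of n] by simp
  from ex_override_fails_at_length[OF \<open>finite D\<close> len_D this X(3) len_X X(2) n(3), of M orc]
  obtain L1 f where L1: "L1 \<subseteq> X"
    and f: "\<forall>xs\<in>D. length (f xs) = k n \<and> f xs \<noteq> map (\<lambda>x. x \<in> L1) xs"
    and fails: "fails_at_length M (poly p n) (poly q n) n (override_on orc f D) L1"
    by blast
  define orc' where "orc' = override_on orc f D"
  define L' where "L' = L \<union> L1"
  have len_L1: "length x = n" if "x \<in> L1" for x using that L1 X(1) by auto
  \<comment> \<open>\<open>L\<close> has no word of length \<open>n\<close>, as
    \<open>N < n\<close>.\<close>
  have L'_n: "x \<in> L' \<longleftrightarrow> x \<in> L1" if "length x = n" for x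
    using that L[of x] n(1) by (auto simp: L'_def)
  have L'_other: "x \<in> L' \<longleftrightarrow> x \<in> L" if "length x \<noteq> n" for x
    using that len_L1[of x] by (auto simp: L'_def)
  have "tuple_length xs = n" if "xs \<in> D" for xs
    using that k_pos[of n] by (intro tuple_length_eq) (auto simp: D_def)
  then have agree: "orc' xs = orc xs" if "tuple_length xs \<le> N" for xs
    using that n(1) by (auto simp: orc'_def override_on_def)
  have rep': "rejects_repetitions orc'"
    using rep by (auto simp: rejects_repetitions_def orc'_def override_on_def D_def)
  have exc': "excludes_membership_vector k L' orc'"
    unfolding excludes_membership_vector_def
  proof (intro allI impI)
    fix m and xs :: "bool list list" assume xs: "length xs = k m \<and> (\<forall>x\<in>set xs. length x = m)"
    show "length (orc' xs) = k m \<and> orc' xs \<noteq> map (\<lambda>x. x \<in> L') xs"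
    proof (cases "distinct xs")
      case False
      with rep' xs show ?thesis unfolding rejects_repetitions_def by metis
    next
      case True
      show ?thesis
      proof (cases "m = n")
        case True
        with \<open>distinct xs\<close> xs have "xs \<in> D" by (simp add: D_def)
        moreover have "map (\<lambda>x. x \<in> L') xs = map (\<lambda>x. x \<in> L1) xs"
          using xs True L'_n by (intro map_cong) auto
        moreover have "orc' xs = f xs" using \<open>xs \<in> D\<close> by (simp add: orc'_def)
        ultimately show ?thesis using f True by metis
      next
        case False
        \<comment> \<open>As \<open>k m \<ge> 1\<close>, the tuple contains a word, and its length
          is \<open>m\<close>, not \<open>n\<close>.\<close>
        then have "xs \<notin> D" using xs k_pos[of m] by (cases xs) (auto simp: D_def)
        moreover have "map (\<lambda>x. x \<in> L') xs = map (\<lambda>x. x \<in> L) xs"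
          using xs False L'_other by (intro map_cong) auto
        moreover have "length (orc xs) = k m \<and> orc xs \<noteq> map (\<lambda>x. x \<in> L) xs"
          using exc xs unfolding excludes_membership_vector_def by blast
        ultimately show ?thesis by (simp only: orc'_def override_on_apply_notin simp_thms)
      qed
    qed
  qed
  have "fails_at_length M (poly p n) (poly q n) n orc' L'"
    using fails L'_n unfolding fails_at_length_def orc'_def by metis
  moreover have "length x \<le> max n (poly q n)" if "x \<in> L'" for x
    using that L[of x] len_L1[of x] n(1) by (auto simp: L'_def)
  moreover have "x \<in> L' \<longleftrightarrow> x \<in> L" if "length x \<le> N" for x
    using that n(1) L'_other[of x] by auto
  ultimately show ?thesis
    using rep' exc' agree n(1)
    \<comment> \<open>\<open>max n (poly q n)\<close> covers the words of length \<open>n\<close>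
      and every query of the defeated run, so later stages leave the failure intact.\<close>
    by (intro exI[of _ orc'] exI[of _ L'] exI[of _ "max n (poly q n)"] exI[of _ n]) auto
qed

section \<open>Defeating all machines and passing to the limit\<close>

theorem theorem5p2:
  fixes k :: "nat \<Rightarrow> nat"
  assumes k_pos: "\<And>n. k n \<ge> 1"
    and k_growth: "(\<lambda>n. real (k n)) \<in> \<omega>(\<lambda>n. log 2 (real n))"
  shows "\<exists>(L :: bool list set) (orc :: oracle_fun).
           excludes_membership_vector k L orc \<and>
           \<not> poly_time_computable_with_advice orc L"
proof -
  obtain orc0 where orc0: "rejects_repetitions orc0" "excludes_membership_vector k {} orc0"
    using ex_initial_oracle k_pos by blast
  \<comment> \<open>Advice sequences are not enumerated, being uncountably many: a stage defeats all
    admissible advice strings for its length at once.\<close>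
  have "countable (UNIV :: (otm \<times> nat poly \<times> nat poly) set)"
    using countable_otm countable_nat_poly by (simp flip: UNIV_Times_UNIV)
  then obtain e :: "nat \<Rightarrow> otm \<times> nat poly \<times> nat poly" where e: "range e = UNIV"
    by (rule that[OF range_from_nat_into[OF UNIV_not_empty]])
  define P :: "oracle_fun \<times> bool list set \<times> nat \<Rightarrow> bool" where
    "P = (\<lambda>(orc, L, N). rejects_repetitions orc \<and> excludes_membership_vector k L orc \<and>
       (\<forall>x\<in>L. length x \<le> N))"
  define Q :: "nat \<Rightarrow> oracle_fun \<times> bool list set \<times> nat \<Rightarrow> oracle_fun \<times> bool list set \<times> nat \<Rightarrow> bool" where
    "Q s = (\<lambda>(orc, L, N) (orc', L', N'). N < N' \<and>
       (\<forall>xs. tuple_length xs \<le> N \<longrightarrow> orc' xs = orc xs) \<and>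
       (\<forall>x. length x \<le> N \<longrightarrow> (x \<in> L' \<longleftrightarrow> x \<in> L)) \<and>
       (case e s of (M, p, q) \<Rightarrow>
          \<exists>n. n \<le> N' \<and> poly q n \<le> N' \<and> fails_at_length M (poly p n) (poly q n) n orc' L'))" for s
  have "\<exists>st. \<forall>s. P (st s) \<and> Q s (st s) (st (Suc s))"
  proof (rule dependent_nat_choice[where P = "\<lambda>_. P"])
    show "\<exists>st. P st"
      using orc0 by (intro exI[of _ "(orc0, {}, 0)"]) (simp add: P_def)
  next
    fix st s assume "P st"
    moreover obtain orc L N where st: "st = (orc, L, N)" by (cases st)
    moreover obtain M p q where es: "e s = (M, p, q)" by (cases "e s")
    ultimately obtain orc' L' N' n where
      "rejects_repetitions orc' \<and> excludes_membership_vector k L' orc' \<and>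
           (\<forall>x\<in>L'. length x \<le> N') \<and> N < N' \<and>
           (\<forall>xs. tuple_length xs \<le> N \<longrightarrow> orc' xs = orc xs) \<and>
           (\<forall>x. length x \<le> N \<longrightarrow> (x \<in> L' \<longleftrightarrow> x \<in> L)) \<and>
           n \<le> N' \<and> poly q n \<le> N' \<and> fails_at_length M (poly p n) (poly q n) n orc' L'"
      using ex_next_stage[OF k_pos k_growth, of orc L N q M p] by (auto simp: P_def)
    then show "\<exists>st'. P st' \<and> Q s st st'"
      by (intro exI[of _ "(orc', L', N')"]) (auto simp: P_def Q_def st es)
  qed
  then obtain st where P: "\<And>s. P (st s)" and Q: "\<And>s. Q s (st s) (st (Suc s))"
    by blast
  define orc where "orc s = fst (st s)" for s
  define L where "L s = fst (snd (st s))" for s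
  define N where "N s = snd (snd (st s))" for s
  have st: "st s = (orc s, L s, N s)" for s by (simp add: orc_def L_def N_def)
  have exc: "excludes_membership_vector k (L s) (orc s)" for s
    using P[of s] by (simp add: P_def st)
  have N_less: "N s < N (Suc s)"
    and orc_Suc: "tuple_length xs \<le> N s \<Longrightarrow> orc (Suc s) xs = orc s xs"
    and L_Suc: "length x \<le> N s \<Longrightarrow> x \<in> L (Suc s) \<longleftrightarrow> x \<in> L s" for s xs x
    using Q[of s] by (auto simp: Q_def st)
  have N_mono: "strict_mono N" using N_less by (simp add: strict_mono_Suc_iff)
  have orc_stable: "orc t xs = orc s xs" if "s \<le> t" "tuple_length xs \<le> N s" for s t xs
    using that(1)
  proof (induction t rule: dec_induct)
    case (step t)
    with that(2) orc_Suc[of xs t] strict_mono_less_eq[OF N_mono, of s t] show ?case by simp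
  qed simp
  have L_stable: "x \<in> L t \<longleftrightarrow> x \<in> L s" if "s \<le> t" "length x \<le> N s" for s t x
    using that(1)
  proof (induction t rule: dec_induct)
    case (step t)
    with that(2) L_Suc[of x t] strict_mono_less_eq[OF N_mono, of s t] show ?case by simp
  qed simp
  \<comment> \<open>Since \<open>s \<le> N s\<close>, the answer to a tuple of
    \<open>tuple_length\<close> \<open>s\<close> no longer changes after stage
    \<open>s\<close>.\<close>
  define orc_lim where "orc_lim xs = orc (tuple_length xs) xs" for xs
  define L_lim where "L_lim = {x. x \<in> L (length x)}"
  have N_ge: "s \<le> N s" for s using N_mono by (rule strict_mono_imp_increasing)
  have orc_lim: "orc_lim xs = orc s xs" if "tuple_length xs \<le> N s" for s xs
    using orc_stable[of s "tuple_length xs" xs] orc_stable[of "tuple_length xs" s xs] that N_ge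
    by (cases "s \<le> tuple_length xs") (auto simp: orc_lim_def)
  have L_lim: "x \<in> L_lim \<longleftrightarrow> x \<in> L s" if "length x \<le> N s" for s x
    using L_stable[of s "length x" x] L_stable[of "length x" s x] that N_ge
    by (cases "s \<le> length x") (auto simp: L_lim_def)
  have "excludes_membership_vector k L_lim orc_lim"
    unfolding excludes_membership_vector_def
  proof (intro allI impI)
    fix n and xs :: "bool list list" assume xs: "length xs = k n \<and> (\<forall>x\<in>set xs. length x = n)"
    with k_pos[of n] have "tuple_length xs = n" by (intro tuple_length_eq) auto
    \<comment> \<open>Answer and membership bits are all read off at the same stage
      \<open>n\<close>, where exclusion is known.\<close>
    then have "orc_lim xs = orc n xs" by (simp add: orc_lim_def)
    moreover have "map (\<lambda>x. x \<in> L_lim) xs = map (\<lambda>x. x \<in> L n) xs"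
      using xs by (intro map_cong) (auto simp: L_lim_def)
    moreover have "length (orc n xs) = k n \<and> orc n xs \<noteq> map (\<lambda>x. x \<in> L n) xs"
      using exc[of n] xs unfolding excludes_membership_vector_def by blast
    ultimately show "length (orc_lim xs) = k n \<and> orc_lim xs \<noteq> map (\<lambda>x. x \<in> L_lim) xs"
      by (simp only: simp_thms)
  qed
  moreover have "\<not> poly_time_computable_with_advice orc_lim L_lim"
  proof
    assume "poly_time_computable_with_advice orc_lim L_lim"
    then obtain M p a q where M: "well_formed M" and a: "\<And>n. length (a n) \<le> poly p n"
      and comp: "computes_in_time M orc_lim a (poly q) L_lim"
      unfolding poly_time_computable_with_advice_def by blast
    obtain s where s: "e s = (M, p, q)" using e by (metis UNIV_I imageE)
    \<comment> \<open>Stage \<open>s\<close> defeated exactly this triple, and the bounds by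
      \<open>N (Suc s)\<close> carry the failure over to the limit.\<close>
    with Q[of s] obtain n where n: "n \<le> N (Suc s)" "poly q n \<le> N (Suc s)"
      "fails_at_length M (poly p n) (poly q n) n (orc (Suc s)) (L (Suc s))"
      by (auto simp: Q_def st)
    then have "fails_at_length M (poly p n) (poly q n) n orc_lim L_lim"
      using orc_lim L_lim by (intro fails_at_length_cong[OF M n(3) n(2) n(1)]) auto
    with a comp show False
      unfolding fails_at_length_def computes_in_time_def by metis
  qed
  ultimately show ?thesis by blast
qed

end
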